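(* For every even positive integer $a$, there exists a structured $(a,1)$ knight's tour in $[6a+2]^2$.
   Context: $[N]=\{0,\dots,N-1\}$. The $(a,1)$ knight's graph on $[N]^2$ has vertex set $[N]^2$, with $(x,y)\sim(x',y')$ iff $\{|x-x'|,|y-y'|\}=\{a,1\}$; an $(a,1)$ knight's tour is a Hamiltonian cycle of this graph. It is structured if it contains every edge $\{(i,j),(i+a,\,j+(-1)^j)\}$ with $i,j\in\{0,\dots,a-1\}$. *)

theory Defs
  imports Main
begin

definition board :: "nat \<Rightarrow> (int \<times> int) set" where
  "board N = {0..<int N} \<times> {0..<int N}"

definition knight_edges :: "nat \<Rightarrow> nat \<Rightarrow> (int \<times> int) set set" where
  "knight_edges a N =
     {{(x, y), (x', y')} | x y x' y'.
        (x, y) \<in> board N \<and> (x', y') \<in> board N \<and>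
        {\<bar>x - x'\<bar>, \<bar>y - y'\<bar>} = {int a, 1}}"

text \<open>A cycle in a simple graph is represented by the list of its vertices in cyclic order,
  starting anywhere and in either direction.\<close>

definition cycle_edges :: "'a list \<Rightarrow> 'a set set" where
  "cycle_edges vs = {{vs ! k, vs ! (Suc k mod length vs)} | k. k < length vs}"

definition hamiltonian_cycle :: "'a set \<Rightarrow> 'a set set \<Rightarrow> 'a list \<Rightarrow> bool" where
  "hamiltonian_cycle V E vs \<longleftrightarrow>
     3 \<le> length vs \<and> distinct vs \<and> set vs = V \<and> cycle_edges vs \<subseteq> E"

definition knight_tour :: "nat \<Rightarrow> nat \<Rightarrow> (int \<times> int) list \<Rightarrow> bool" where
  "knight_tour a N vs \<longleftrightarrow> hamiltonian_cycle (board N) (knight_edges a N) vs"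

definition structured :: "nat \<Rightarrow> (int \<times> int) list \<Rightarrow> bool" where
  "structured a vs \<longleftrightarrow>
     (\<forall>i<a. \<forall>j<a.
        {(int i, int j), (int i + int a, int j + (- 1) ^ j)} \<in> cycle_edges vs)"

end

theory Submission
  imports Defs
begin

text \<open>
  Put \<open>a = 2 * h\<close> and group the residues modulo \<open>a\<close> into pairs \<open>{2 * I, 2 * I + 1}\<close>. Moves that
  change one coordinate by \<open>a\<close> and toggle the other one inside its pair split the board into grid
  graphs of sizes \<open>6 \<times> 6\<close>, \<open>6 \<times> 7\<close>, \<open>7 \<times> 6\<close> and \<open>7 \<times> 7\<close>. Grids of the first two kinds, lying over
  the column pairs \<open>I > 0\<close>, have Hamiltonian cycles. Hamiltonian paths of the grids over \<open>I = 0\<close> can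
  be chained into two long cycles; this takes care of the odd \<open>7 \<times> 7\<close> grids. All these cycles are
  then merged along vertex-disjoint 4-cycles of the knight's graph, each trading two parallel edges
  of the cover for the other two sides. A structured edge is the edge at the corner
  \<open>(0, 0)--(1, 0)\<close> of its grid, hence belongs to the cover, and no merging touches it.
\<close>

section \<open>Merging a cycle cover\<close>

fun path_edges :: "'a list \<Rightarrow> 'a set set" where
  "path_edges (x # y # zs) = insert {x, y} (path_edges (y # zs))"
| "path_edges _ = {}"

lemma path_edges_append:
  "xs \<noteq> [] \<Longrightarrow> ys \<noteq> [] \<Longrightarrow>
    path_edges (xs @ ys) = insert {last xs, hd ys} (path_edges xs \<union> path_edges ys)"
proof (induction xs rule: path_edges.induct)
  case ("2_2" x)
  then show ?case by (cases ys) auto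
qed auto

lemma path_edges_map: "path_edges (map f xs) = (`) f ` path_edges xs"
  by (induction xs rule: path_edges.induct) auto

lemma path_edges_rev: "path_edges (rev xs) = path_edges xs"
proof (induction xs rule: path_edges.induct)
  case (1 x y zs)
  then show ?case
    using path_edges_append[of "rev zs @ [y]" "[x]"] by (auto simp: insert_commute)
qed auto

lemma path_edges_nth: "path_edges xs = {{xs ! k, xs ! Suc k} | k. Suc k < length xs}"
proof (induction xs rule: path_edges.induct)
  case (1 x y zs)
  have "{{(x # y # zs) ! k, (x # y # zs) ! Suc k} | k. Suc k < length (x # y # zs)} =
    insert {x, y} {{(y # zs) ! k, (y # zs) ! Suc k} | k. Suc k < length (y # zs)}"
    (is "?L = insert _ ?R")
  proof (intro set_eqI iffI)
    fix e assume "e \<in> ?L"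
    then obtain k where "e = {(x # y # zs) ! k, (x # y # zs) ! Suc k}" "Suc k < length (x # y # zs)"
      by auto
    then show "e \<in> insert {x, y} ?R" by (cases k) auto
  next
    fix e assume "e \<in> insert {x, y} ?R"
    then consider "e = {x, y}" | k where "e = {(y # zs) ! k, (y # zs) ! Suc k}" "Suc k < length (y # zs)"
      by auto
    then show "e \<in> ?L"
    proof cases
      case 1
      then show ?thesis by (intro CollectI exI[of _ 0]) auto
    next
      case (2 k)
      then show ?thesis by (intro CollectI exI[of _ "Suc k"]) auto
    qed
  qed
  then show ?case using 1 by simp
qed auto

text \<open>Carries the executable check on consecutive entries, as used in
  \<open>good_path\<close>, over to the edge set.\<close>

lemma path_edges_successive:
  assumes "list_all (\<lambda>(x, y). R x y) (zip xs (tl xs))" "e \<in> path_edges xs"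
  shows "\<exists>x y. e = {x, y} \<and> x \<in> set xs \<and> y \<in> set xs \<and> R x y"
  using assms
proof (induction xs rule: path_edges.induct)
  case (1 x y zs)
  show ?case
  proof (cases "e = {x, y}")
    case True
    then show ?thesis using 1(2) by (intro exI[of _ x] exI[of _ y]) simp
  next
    case False
    then show ?thesis using 1 by fastforce
  qed
qed simp_all

lemma path_edges_subset_append:
  "path_edges xs \<subseteq> path_edges (xs @ ys)" "path_edges ys \<subseteq> path_edges (xs @ ys)"
  by (cases "xs = [] \<or> ys = []"; auto simp: path_edges_append)+

lemma path_edges_subset_concat:
  assumes "xs \<in> set xss"
  shows "path_edges xs \<subseteq> path_edges (concat xss)"
proof -
  obtain yss zss where "xss = yss @ xs # zss" using split_list[OF assms] by blast
  then have "concat xss = concat yss @ xs @ concat zss" by simp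
  then show ?thesis using path_edges_subset_append by (metis order_trans)
qed

lemma hd_concat_upt:
  assumes "f 0 \<noteq> []" "0 < n"
  shows "hd (concat (map f [0..<n])) = hd (f 0)"
  using assms by (simp add: upt_conv_Cons)

lemma last_concat_upt:
  assumes "f n \<noteq> []"
  shows "last (concat (map f [0..<Suc n])) = last (f n)"
  using assms by simp

lemma path_edges_concat_subset:
  assumes "\<And>k. k < n \<Longrightarrow> f k \<noteq> [] \<and> path_edges (f k) \<subseteq> E"
    and "\<And>k. Suc k < n \<Longrightarrow> {last (f k), hd (f (Suc k))} \<in> E"
  shows "path_edges (concat (map f [0..<n])) \<subseteq> E"
  using assms
proof (induction n)
  case (Suc n)
  show ?case
  proof (cases n)
    case 0
    then show ?thesis using Suc.prems by simp
  next
    case (Suc m)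
    define xs where "xs = concat (map f [0..<n])"
    have last: "last xs = last (f m)"
      unfolding xs_def Suc by (rule last_concat_upt) (use Suc.prems Suc in simp)
    have "xs \<noteq> []" unfolding xs_def using Suc.prems(1)[of m] Suc by simp
    moreover have "f n \<noteq> []" "path_edges (f n) \<subseteq> E" using Suc.prems(1) by simp_all
    moreover have "{last xs, hd (f n)} \<in> E" using Suc.prems(2)[of m] Suc last by simp
    moreover have "path_edges xs \<subseteq> E" unfolding xs_def using Suc.IH Suc.prems by simp
    moreover have "concat (map f [0..<Suc n]) = xs @ f n" unfolding xs_def by simp
    ultimately show ?thesis by (simp add: path_edges_append)
  qed
qed simp

lemma distinct_concat_upt:
  assumes "\<And>k. k < n \<Longrightarrow> distinct (f k)"
    and "\<And>j k. j < n \<Longrightarrow> k < n \<Longrightarrow> j \<noteq> k \<Longrightarrow> set (f j) \<inter> set (f k) = {}"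
  shows "distinct (concat (map f [0..<n]))"
  using assms
proof (induction n)
  case (Suc n)
  have "set (f k) \<inter> set (f n) = {}" if "k < n" for k using Suc.prems(2)[of k n] that by simp
  then have "set (concat (map f [0..<n])) \<inter> set (f n) = {}" by (auto simp: disjoint_iff)
  moreover have "distinct (concat (map f [0..<n]))" "distinct (f n)" using Suc by simp_all
  ultimately show ?case by simp
qed simp

section \<open>Cycles as closed paths: reversal, rotation and cutting\<close>

lemma cycle_edges_path_edges:
  assumes "xs \<noteq> []"
  shows "cycle_edges xs = insert {last xs, hd xs} (path_edges xs)"
proof (intro set_eqI iffI)
  fix e assume "e \<in> cycle_edges xs"
  then obtain k where k: "e = {xs ! k, xs ! (Suc k mod length xs)}" "k < length xs"
    unfolding cycle_edges_def by auto
  show "e \<in> insert {last xs, hd xs} (path_edges xs)"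
  proof (cases "Suc k < length xs")
    case True
    then show ?thesis using k by (auto simp: path_edges_nth)
  next
    case False
    then have "Suc k mod length xs = 0" "k = length xs - 1" using k by (auto simp: not_less le_Suc_eq)
    then show ?thesis using k(1) assms by (simp add: last_conv_nth hd_conv_nth)
  qed
next
  fix e assume "e \<in> insert {last xs, hd xs} (path_edges xs)"
  then consider "e = {last xs, hd xs}" | k where "e = {xs ! k, xs ! Suc k}" "Suc k < length xs"
    by (auto simp: path_edges_nth)
  then show "e \<in> cycle_edges xs"
  proof cases
    case 1
    then show ?thesis unfolding cycle_edges_def using assms
      by (intro CollectI exI[of _ "length xs - 1"]) (auto simp: last_conv_nth hd_conv_nth)
  next
    case (2 k)
    then show ?thesis unfolding cycle_edges_def by (intro CollectI exI[of _ k]) auto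
  qed
qed

lemma cycle_edges_rev: "cycle_edges (rev xs) = cycle_edges xs"
proof (cases "xs = []")
  case False
  then show ?thesis
    by (simp add: cycle_edges_path_edges path_edges_rev hd_rev last_rev insert_commute)
qed simp

lemma cycle_edges_rotate: "cycle_edges (rotate n xs) = cycle_edges xs"
proof (induction n)
  case (Suc n)
  have "cycle_edges (rotate1 ys) = cycle_edges ys" for ys :: "'a list"
  proof (cases ys)
    case (Cons y zs)
    show ?thesis
    proof (cases "zs = []")
      case False
      then have "path_edges (y # zs) = insert {y, hd zs} (path_edges zs)"
        by (cases zs) auto
      then show ?thesis using Cons False
        by (auto simp: cycle_edges_path_edges path_edges_append)
    qed (use Cons in auto)
  qed simp
  then show ?case using Suc by simp
qed simp

text \<open>Rotation moves the edge to the seam between the last and the first entry; reversal, if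
  needed, corrects its orientation.\<close>

lemma cycle_cut_at_edge:
  assumes "{u, v} \<in> cycle_edges c"
  obtains c' where "set c' = set c" "length c' = length c" "distinct c' = distinct c"
    "cycle_edges c' = cycle_edges c" "hd c' = v" "last c' = u"
proof -
  obtain k where k: "{u, v} = {c ! k, c ! (Suc k mod length c)}" "k < length c"
    using assms unfolding cycle_edges_def by auto
  \<comment> \<open>Rotating by \<open>Suc k\<close> rather than \<open>k\<close> makes
    \<open>c ! k\<close> the last entry.\<close>
  define r where "r = rotate (Suc k) c"
  have "hd r = c ! (Suc k mod length c)"
    using k unfolding r_def by (intro hd_rotate_conv_nth) auto
  have "last r = r ! (length c - 1)"
    using k unfolding r_def by (subst last_conv_nth) (auto simp del: rotate_Suc)
  also have "\<dots> = c ! ((Suc k + (length c - 1)) mod length c)"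
    using k unfolding r_def by (subst nth_rotate) auto
  also have "Suc k + (length c - 1) = k + length c" using k by simp
  also have "(k + length c) mod length c = k" using k by simp
  finally have l: "last r = c ! k" .
  have r: "set r = set c" "length r = length c" "distinct r = distinct c"
    "cycle_edges r = cycle_edges c" "r \<noteq> []"
    using k unfolding r_def by (auto simp: cycle_edges_rotate simp del: rotate_Suc)
  have "u = last r \<and> v = hd r \<or> v = last r \<and> u = hd r"
    using k l \<open>hd r = _\<close> by (auto simp: doubleton_eq_iff)
  then show ?thesis
  proof
    assume "u = last r \<and> v = hd r"
    then show ?thesis using that[of r] r by simp
  next
    assume "v = last r \<and> u = hd r"
    then show ?thesis using that[of "rev r"] r by (simp add: cycle_edges_rev hd_rev last_rev)
  qed
qed

text \<open>A 2-factor, listed by its cycles. Since members are nonempty, disjointness also prevents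
  two different lists of one and the same cycle from both occurring.\<close>

definition cycle_cover :: "'a set \<Rightarrow> 'a set set \<Rightarrow> 'a list set \<Rightarrow> bool" where
  "cycle_cover V E CS \<longleftrightarrow> finite CS \<and>
     (\<forall>c\<in>CS. 3 \<le> length c \<and> distinct c \<and> cycle_edges c \<subseteq> E) \<and>
     (\<forall>c\<in>CS. \<forall>d\<in>CS. c \<noteq> d \<longrightarrow> set c \<inter> set d = {}) \<and>
     \<Union> (set ` CS) = V"

lemma cycle_edges_subset: "e \<in> cycle_edges c \<Longrightarrow> e \<subseteq> set c"
proof -
  assume "e \<in> cycle_edges c"
  then obtain k where k: "e = {c ! k, c ! (Suc k mod length c)}" "k < length c"
    unfolding cycle_edges_def by auto
  then have "Suc k mod length c < length c" by (intro mod_less_divisor) auto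
  then show "e \<subseteq> set c" using k by auto
qed

text \<open>Cut \<open>c\<close> open to a path from \<open>v\<close> to \<open>u\<close> and
  \<open>d\<close> to a path from \<open>w\<close> to \<open>z\<close>. Their concatenation has
  \<open>{u, w}\<close> at the joint and \<open>{v, z}\<close> at the seam. Freshness of
  \<open>m\<close> lets the number of cycles drop by exactly one.\<close>

lemma merge_two_cycles:
  assumes cover: "cycle_cover V E CS" and cd: "c \<in> CS" "d \<in> CS" "c \<noteq> d"
    and uv: "{u, v} \<in> cycle_edges c" and wz: "{w, z} \<in> cycle_edges d"
    and E: "{u, w} \<in> E" "{v, z} \<in> E"
  obtains m where "cycle_cover V E (insert m (CS - {c, d}))" "set m = set c \<union> set d"
    "cycle_edges c \<union> cycle_edges d - {{u, v}, {w, z}} \<subseteq> cycle_edges m"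
    "m \<notin> CS - {c, d}"
proof -
  obtain c' where c': "set c' = set c" "length c' = length c" "distinct c' = distinct c"
    "cycle_edges c' = cycle_edges c" "hd c' = v" "last c' = u"
    using cycle_cut_at_edge[OF uv] by metis
  have "{z, w} \<in> cycle_edges d" using wz by (simp add: insert_commute)
  then obtain d' where d': "set d' = set d" "length d' = length d" "distinct d' = distinct d"
    "cycle_edges d' = cycle_edges d" "hd d' = w" "last d' = z"
    using cycle_cut_at_edge by metis
  have len: "3 \<le> length c" "3 \<le> length d" and dist: "distinct c" "distinct d"
    and sub: "cycle_edges c \<subseteq> E" "cycle_edges d \<subseteq> E" and disj: "set c \<inter> set d = {}"
    using cover cd unfolding cycle_cover_def by blast+
  have ne: "c' \<noteq> []" "d' \<noteq> []" using len c' d' by auto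
  define m where "m = c' @ d'"
  have ce: "cycle_edges c = insert {u, v} (path_edges c')" "cycle_edges d = insert {w, z} (path_edges d')"
    using cycle_edges_path_edges[OF ne(1)] cycle_edges_path_edges[OF ne(2)] c' d'
    by (auto simp: insert_commute)
  have me: "cycle_edges m = insert {u, w} (insert {v, z} (path_edges c' \<union> path_edges d'))"
    unfolding m_def using ne c' d'
    by (auto simp: cycle_edges_path_edges path_edges_append insert_commute)
  have setm: "set m = set c \<union> set d" unfolding m_def using c' d' by simp
  have "m \<notin> CS - {c, d}"
  proof
    assume "m \<in> CS - {c, d}"
    then have "set m \<inter> set c = {}" using cover cd unfolding cycle_cover_def by blast
    then show False using setm len by auto
  qed
  moreover have "cycle_cover V E (insert m (CS - {c, d}))"
    unfolding cycle_cover_def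
  proof (intro conjI ballI impI)
    show "finite (insert m (CS - {c, d}))" using cover unfolding cycle_cover_def by simp
    fix x assume x: "x \<in> insert m (CS - {c, d})"
    have "3 \<le> length m" "distinct m" "cycle_edges m \<subseteq> E"
      using c' d' len dist disj me ce sub E unfolding m_def by auto
    then show "3 \<le> length x" "distinct x" "cycle_edges x \<subseteq> E"
      using x cover unfolding cycle_cover_def by blast+
    fix y assume y: "y \<in> insert m (CS - {c, d})" "x \<noteq> y"
    show "set x \<inter> set y = {}"
      using x y setm cover cd unfolding cycle_cover_def by blast
  next
    show "\<Union> (set ` insert m (CS - {c, d})) = V"
    proof -
      have "CS = {c, d} \<union> (CS - {c, d})" using cd by auto
      then have "\<Union> (set ` CS) = \<Union> (set ` ({c, d} \<union> (CS - {c, d})))" by (rule arg_cong)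
      then have "\<Union> (set ` CS) = set m \<union> \<Union> (set ` (CS - {c, d}))"
        unfolding setm image_Un Union_Un_distrib by simp
      then show ?thesis using cover unfolding cycle_cover_def by simp
    qed
  qed
  moreover have "cycle_edges c \<union> cycle_edges d - {{u, v}, {w, z}} \<subseteq> cycle_edges m"
    using me ce by auto
  ultimately show ?thesis using that setm by blast
qed

fun switch_verts :: "'a \<times> 'a \<times> 'a \<times> 'a \<Rightarrow> 'a set" where
  "switch_verts (u, v, w, z) = {u, v, w, z}"

text \<open>When the edges uv and wz lie on different cycles, trading them for uw and vz merges the two
  cycles, whatever their orientations.\<close>

definition switches :: "'a set set \<Rightarrow> 'a set set \<Rightarrow> ('a \<times> 'a \<times> 'a \<times> 'a) set \<Rightarrow> bool" where
  "switches E U S \<longleftrightarrow>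
     (\<forall>(u, v, w, z)\<in>S. {u, v} \<in> U \<and> {w, z} \<in> U \<and> {u, w} \<in> E \<and> {v, z} \<in> E) \<and>
     (\<forall>s\<in>S. \<forall>t\<in>S. s \<noteq> t \<longrightarrow> switch_verts s \<inter> switch_verts t = {})"

text \<open>Induction on the number of cycles. The last hypothesis expresses by cuts that the
  cycles, with the switches as edges between them, form a connected graph: a union of cycles crossed
  by no switch is trivial. In this form connectivity passes to the merged cover without any explicit
  quotient graph.\<close>

lemma hamiltonian_cycle_from_switches:
  assumes "cycle_cover V E CS" "CS \<noteq> {}"
    and "switches E (\<Union> (cycle_edges ` CS)) S"
    and "K \<subseteq> \<Union> (cycle_edges ` CS)"
    and "\<And>e s. e \<in> K \<Longrightarrow> s \<in> S \<Longrightarrow> e \<inter> switch_verts s = {}"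
    and "\<And>P. (\<And>c. c \<in> CS \<Longrightarrow> set c \<subseteq> P \<or> set c \<inter> P = {}) \<Longrightarrow>
            (\<And>u v w z. (u, v, w, z) \<in> S \<Longrightarrow> u \<in> P \<longleftrightarrow> w \<in> P) \<Longrightarrow> V \<inter> P = {} \<or> V \<subseteq> P"
  shows "\<exists>vs. hamiltonian_cycle V E vs \<and> K \<subseteq> cycle_edges vs"
  using assms
proof (induction "card CS" arbitrary: CS S rule: less_induct)
  case less
  note cover = less.prems(1) and sw = less.prems(3) and K = less.prems(4,5) and conn = less.prems(6)
  obtain b where b: "b \<in> CS" using less.prems(2) by blast
  show ?case
  proof (cases "CS = {b}")
    case True
    then show ?thesis using cover K unfolding cycle_cover_def hamiltonian_cycle_def by auto
  next
    case False
    then obtain b' where b': "b' \<in> CS" "b' \<noteq> b" using b by blast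
    have disj: "\<And>c d. c \<in> CS \<Longrightarrow> d \<in> CS \<Longrightarrow> c \<noteq> d \<Longrightarrow> set c \<inter> set d = {}"
      and ne: "\<And>c. c \<in> CS \<Longrightarrow> set c \<noteq> {}" and V: "\<And>c. c \<in> CS \<Longrightarrow> set c \<subseteq> V"
      using cover unfolding cycle_cover_def by fastforce+
    obtain x y where xy: "x \<in> set b" "y \<in> set b'" using ne[OF b] ne[OF b'(1)] by (meson equals0I)
    then have "x \<in> V" "y \<in> V" "y \<notin> set b" using V disj b b' by blast+
    \<comment> \<open>The connectivity hypothesis is applied to the cut \<open>set b\<close>: as
      \<open>b\<close> is not the only cycle, some switch must cross it, and that switch joins two
      different cycles.\<close>
    then have "\<not> (V \<inter> set b = {} \<or> V \<subseteq> set b)" using xy by blast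
    moreover have "set c \<subseteq> set b \<or> set c \<inter> set b = {}" if "c \<in> CS" for c
      using disj[OF that b] by blast
    ultimately obtain u v w z where s: "(u, v, w, z) \<in> S" and uw: "u \<in> set b \<longleftrightarrow> w \<notin> set b"
      using conn[of "set b"] by blast
    have "{u, v} \<in> \<Union> (cycle_edges ` CS)" "{w, z} \<in> \<Union> (cycle_edges ` CS)"
      and E: "{u, w} \<in> E" "{v, z} \<in> E"
      using sw s unfolding switches_def by auto
    then obtain c d where cd: "c \<in> CS" "d \<in> CS" and uv: "{u, v} \<in> cycle_edges c"
      and wz: "{w, z} \<in> cycle_edges d" by blast
    have uc: "u \<in> set c" and wd: "w \<in> set d"
      using cycle_edges_subset[OF uv] cycle_edges_subset[OF wz] by auto
    then have "c \<noteq> d" using uw disj b cd by blast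
    obtain m where m: "cycle_cover V E (insert m (CS - {c, d}))" "set m = set c \<union> set d"
      "cycle_edges c \<union> cycle_edges d - {{u, v}, {w, z}} \<subseteq> cycle_edges m" "m \<notin> CS - {c, d}"
      using merge_two_cycles[OF cover cd \<open>c \<noteq> d\<close> uv wz E] by blast
    let ?CS = "insert m (CS - {c, d})" and ?S = "S - {(u, v, w, z)}"
    \<comment> \<open>Edges that avoid the four vertices of the switch survive the merge. This
      serves both the remaining switches and \<open>K\<close>.\<close>
    have keep: "e \<in> \<Union> (cycle_edges ` ?CS)"
      if "e \<in> \<Union> (cycle_edges ` CS)" "e \<inter> {u, v, w, z} = {}" for e
    proof -
      have "e \<notin> {{u, v}, {w, z}}" using that(2) by auto
      then show ?thesis using that(1) m(3) by blast
    qed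
    have "finite CS" using cover unfolding cycle_cover_def by blast
    have "card ?CS = Suc (card (CS - {c, d}))" using m(4) \<open>finite CS\<close> by simp
    also have "card (CS - {c, d}) = card CS - 2"
      using cd \<open>c \<noteq> d\<close> \<open>finite CS\<close> by (subst card_Diff_subset) auto
    finally have "card ?CS < card CS"
      using card_mono[OF \<open>finite CS\<close>, of "{c, d}"] cd \<open>c \<noteq> d\<close> by simp
    moreover have "switches E (\<Union> (cycle_edges ` ?CS)) ?S"
    proof -
      have "{u', v'} \<in> \<Union> (cycle_edges ` ?CS) \<and> {w', z'} \<in> \<Union> (cycle_edges ` ?CS) \<and>
          {u', w'} \<in> E \<and> {v', z'} \<in> E"
        if "(u', v', w', z') \<in> ?S" for u' v' w' z'
      proof -
        have "{u', v', w', z'} \<inter> {u, v, w, z} = {}"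
          using that s sw unfolding switches_def by fastforce
        moreover have "{u', v'} \<in> \<Union> (cycle_edges ` CS)" "{w', z'} \<in> \<Union> (cycle_edges ` CS)"
          "{u', w'} \<in> E" "{v', z'} \<in> E" using that sw unfolding switches_def by auto
        ultimately show ?thesis using keep[of "{u', v'}"] keep[of "{w', z'}"] by auto
      qed
      then show ?thesis using sw unfolding switches_def by blast
    qed
    moreover have "K \<subseteq> \<Union> (cycle_edges ` ?CS)"
    proof
      fix e assume e: "e \<in> K"
      then have "e \<in> \<Union> (cycle_edges ` CS)" by (rule subsetD[OF K(1)])
      moreover have "e \<inter> {u, v, w, z} = {}" using K(2)[OF e s] by simp
      ultimately show "e \<in> \<Union> (cycle_edges ` ?CS)" by (rule keep)
    qed
    moreover have "V \<inter> P = {} \<or> V \<subseteq> P"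
      if P: "\<And>x. x \<in> ?CS \<Longrightarrow> set x \<subseteq> P \<or> set x \<inter> P = {}"
        and PS: "\<And>u v w z. (u, v, w, z) \<in> ?S \<Longrightarrow> u \<in> P \<longleftrightarrow> w \<in> P" for P
    proof (rule conn)
      \<comment> \<open>The merged cycle lies on one side of \<open>P\<close>, hence so do
        \<open>c\<close> and \<open>d\<close>, and the discarded switch cannot cross
        \<open>P\<close> either.\<close>
      have mP: "set c \<union> set d \<subseteq> P \<or> (set c \<union> set d) \<inter> P = {}" using P[of m] m(2) by simp
      show "set x \<subseteq> P \<or> set x \<inter> P = {}" if "x \<in> CS" for x
        using P[of x] mP that by blast
      show "u' \<in> P \<longleftrightarrow> w' \<in> P" if "(u', v', w', z') \<in> S" for u' v' w' z'
        using PS[of u' v' w' z'] that mP uc wd by blast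
    qed
    moreover have "e \<inter> switch_verts t = {}" if "e \<in> K" "t \<in> ?S" for e t
      using K(2)[OF that(1)] that(2) by blast
    ultimately show ?thesis
      by (intro less.hyps[of ?CS ?S] m(1)) simp_all
  qed
qed

section \<open>Grid graphs inside the knight's graph\<close>

fun grid_adj :: "nat \<times> nat \<Rightarrow> nat \<times> nat \<Rightarrow> bool" where
  "grid_adj (X, Y) (X', Y') \<longleftrightarrow>
     X = X' \<and> (Y' = Suc Y \<or> Y = Suc Y') \<or> Y = Y' \<and> (X' = Suc X \<or> X = Suc X')"

text \<open>The board has side \<open>6 * (2 * h) + 2\<close>, so in each coordinate the residues 0
  and 1 modulo \<open>2 * h\<close> occur seven times and all others six times.\<close>

definition cells :: "nat \<Rightarrow> nat \<Rightarrow> (nat \<times> nat) set" where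
  "cells I J = {..<if I = 0 then 7 else 6} \<times> {..<if J = 0 then 7 else 6}"

text \<open>In a knight's graph with \<open>a = 2 * h\<close>, the points whose coordinates modulo \<open>a\<close> lie in
  \<open>{2 * I, 2 * I + 1} \<times> {2 * J, 2 * J + 1}\<close> carry four disjoint grid graphs, indexed by
  \<open>p, q \<in> {0, 1}\<close>: a unit step of the grid changes one coordinate by \<open>a\<close> and
  toggles the other one inside its pair.\<close>

definition emb :: "nat \<Rightarrow> nat \<Rightarrow> nat \<Rightarrow> nat \<Rightarrow> nat \<Rightarrow> nat \<times> nat \<Rightarrow> int \<times> int" where
  "emb h I J p q = (\<lambda>(X, Y).
     (int (2 * h * X + 2 * I + (p + Y) mod 2), int (2 * h * Y + 2 * J + (q + X) mod 2)))"

section \<open>Block coordinates: the embedded grids partition the board\<close>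

lemma div_mod_block:
  fixes h X I r :: nat
  assumes "I < h" "r < 2"
  shows "(2 * h * X + 2 * I + r) div (2 * h) = X" "(2 * h * X + 2 * I + r) mod (2 * h) = 2 * I + r"
proof -
  have "2 * I + r < 2 * h" using assms by simp
  moreover have "2 * h * X + 2 * I + r = (2 * I + r) + 2 * h * X" by simp
  ultimately show "(2 * h * X + 2 * I + r) div (2 * h) = X"
    "(2 * h * X + 2 * I + r) mod (2 * h) = 2 * I + r"
    by (simp_all only: div_mult_self2 mod_mult_self2) auto
qed

lemma block_unique:
  fixes h X I r :: nat
  assumes "2 * h * X + 2 * I + r = 2 * h * X' + 2 * I' + r'" "I < h" "I' < h" "r < 2" "r' < 2"
  shows "X = X' \<and> I = I' \<and> r = r'"
proof -
  have "X = X'" "2 * I + r = 2 * I' + r'"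
    using div_mod_block[of I h r X] div_mod_block[of I' h r' X'] assms by auto
  then show ?thesis using assms by presburger
qed

text \<open>Uniqueness of block coordinates recovers the cell, the pairs \<open>I\<close>,
  \<open>J\<close> and two parity bits; once \<open>X\<close> and \<open>Y\<close> are known, the
  bits give back \<open>p\<close> and \<open>q\<close>.\<close>

lemma emb_eqD:
  assumes "emb h I J p q c = emb h I' J' p' q' c'" "I < h" "J < h" "I' < h" "J' < h"
    "p < 2" "q < 2" "p' < 2" "q' < 2"
  shows "I = I' \<and> J = J' \<and> p = p' \<and> q = q' \<and> c = c'"
proof -
  obtain X Y X' Y' where c: "c = (X, Y)" "c' = (X', Y')" by fastforce
  have eqs: "2 * h * X + 2 * I + (p + Y) mod 2 = 2 * h * X' + 2 * I' + (p' + Y') mod 2"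
    "2 * h * Y + 2 * J + (q + X) mod 2 = 2 * h * Y' + 2 * J' + (q' + X') mod 2"
    using assms(1) unfolding emb_def c by (simp_all only: prod.case prod.inject of_nat_eq_iff)
  have *: "X = X' \<and> I = I' \<and> (p + Y) mod 2 = (p' + Y') mod 2"
    "Y = Y' \<and> J = J' \<and> (q + X) mod 2 = (q' + X') mod 2"
    using block_unique[OF eqs(1)] block_unique[OF eqs(2)] assms by simp_all
  then have "p = p'" "q = q'" using assms by presburger+
  then show ?thesis using * c by auto
qed

lemma block_exists:
  fixes x :: int
  assumes "0 \<le> x" "x < 12 * int h + 2" "h > 0"
  obtains X I r where "x = int (2 * h * X + 2 * I + r)" "I < h" "r < 2" "X < (if I = 0 then 7 else 6)"
proof -
  obtain n where n: "x = int n" using assms nonneg_int_cases by blast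
  define X I r where "X = n div (2 * h)" and "I = n mod (2 * h) div 2" and "r = n mod 2"
  have "n mod (2 * h) mod 2 = n mod 2" by (simp add: mod_mod_cancel)
  then have "2 * I + r = n mod (2 * h)" unfolding I_def r_def
    by (metis mult_div_mod_eq)
  then have eq: "n = 2 * h * X + 2 * I + r" unfolding X_def
    by (metis mult_div_mod_eq add.assoc)
  have "n mod (2 * h) < 2 * h" using assms by simp
  then have "I < h" unfolding I_def by simp
  have "n < 12 * h + 2" using assms n by simp
  have "X < 7"
  proof (rule ccontr)
    assume "\<not> X < 7"
    then have "2 * h * 7 \<le> 2 * h * X" by (intro mult_le_mono) auto
    then show False using eq \<open>n < 12 * h + 2\<close> \<open>h > 0\<close> by linarith
  qed
  \<comment> \<open>For \<open>I\<close> >= 1 the seventh copy of the pair begins at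
    \<open>12 * h + 2\<close> or later, off the board.\<close>
  moreover have "X < 6" if "I \<noteq> 0"
  proof (rule ccontr)
    assume "\<not> X < 6"
    then have "2 * h * 6 \<le> 2 * h * X" by (intro mult_le_mono) auto
    then show False using eq \<open>n < 12 * h + 2\<close> that by linarith
  qed
  ultimately show ?thesis using that[of X I r] n eq \<open>I < h\<close> unfolding r_def by simp
qed

lemma block_bound:
  fixes h X I r :: nat
  assumes "I < h" "r < 2" "X < (if I = 0 then 7 else 6)"
  shows "2 * h * X + 2 * I + r < 12 * h + 2"
proof (cases "I = 0")
  case True
  then have "2 * h * X \<le> 2 * h * 6" using assms by (intro mult_le_mono) auto
  then show ?thesis using assms(2) True by linarith
next
  case False
  then have "2 * h * X \<le> 2 * h * 5" using assms by (intro mult_le_mono) auto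
  then show ?thesis using assms(1,2) by linarith
qed

lemma emb_in_board:
  assumes "c \<in> cells I J" "I < h" "J < h"
  shows "emb h I J p q c \<in> board (6 * (2 * h) + 2)"
proof -
  obtain X Y where c: "c = (X, Y)" by fastforce
  have "2 * h * X + 2 * I + (p + Y) mod 2 < 12 * h + 2" "2 * h * Y + 2 * J + (q + X) mod 2 < 12 * h + 2"
    using assms unfolding c cells_def by (intro block_bound; auto)+
  then have "int (2 * h * X + 2 * I + (p + Y) mod 2) < int (6 * (2 * h) + 2)"
    "int (2 * h * Y + 2 * J + (q + X) mod 2) < int (6 * (2 * h) + 2)" by linarith+
  then show ?thesis unfolding c emb_def board_def by (simp del: of_nat_add of_nat_mult)
qed

lemma board_cases:
  assumes "v \<in> board (6 * (2 * h) + 2)" "h > 0"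
  obtains I J p q c where "v = emb h I J p q c" "I < h" "J < h" "p < 2" "q < 2" "c \<in> cells I J"
proof -
  obtain x y where v: "v = (x, y)" by fastforce
  have xy: "0 \<le> x" "x < 12 * int h + 2" "0 \<le> y" "y < 12 * int h + 2"
    using assms unfolding v board_def by auto
  obtain X I r where x: "x = int (2 * h * X + 2 * I + r)" "I < h" "r < 2" "X < (if I = 0 then 7 else 6)"
    using block_exists[OF xy(1,2) assms(2)] by metis
  obtain Y J t where y: "y = int (2 * h * Y + 2 * J + t)" "J < h" "t < 2" "Y < (if J = 0 then 7 else 6)"
    using block_exists[OF xy(3,4) assms(2)] by metis
  \<comment> \<open>Adding the grid coordinate once more modulo 2 undoes the twist in
    \<open>emb\<close>, which yields the witnesses for \<open>p\<close> and
    \<open>q\<close>.\<close>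
  have "((r + Y) mod 2 + Y) mod 2 = r" "((t + X) mod 2 + X) mod 2 = t"
    using x y by presburger+
  then have "v = emb h I J ((r + Y) mod 2) ((t + X) mod 2) (X, Y)"
    unfolding v emb_def using x y by simp
  moreover have "(X, Y) \<in> cells I J" using x y unfolding cells_def by auto
  ultimately show ?thesis using that x(2) y(2) by simp
qed

section \<open>Grid steps as knight moves\<close>

lemma knight_edgeI:
  assumes "u \<in> board N" "v \<in> board N"
    and "\<bar>fst u - fst v\<bar> = int a \<and> \<bar>snd u - snd v\<bar> = 1 \<or> \<bar>fst u - fst v\<bar> = 1 \<and> \<bar>snd u - snd v\<bar> = int a"
  shows "{u, v} \<in> knight_edges a N"
proof -
  have "{\<bar>fst u - fst v\<bar>, \<bar>snd u - snd v\<bar>} = {int a, 1}" using assms(3) by auto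
  then have "{(fst u, snd u), (fst v, snd v)} \<in> knight_edges a N"
    unfolding knight_edges_def
    by (intro CollectI exI conjI refl) (use assms(1,2) in simp_all)
  then show ?thesis by simp
qed

lemma abs_mod_2_Suc: "\<bar>int (Suc n mod 2) - int (n mod 2)\<bar> = 1" "\<bar>int (n mod 2) - int (Suc n mod 2)\<bar> = 1"
  by (cases "even n"; simp add: mod_2_eq_odd)+

lemma emb_adj:
  assumes "grid_adj c d" "c \<in> cells I J" "d \<in> cells I J" "I < h" "J < h"
  shows "{emb h I J p q c, emb h I J p q d} \<in> knight_edges (2 * h) (6 * (2 * h) + 2)"
proof (rule knight_edgeI)
  obtain X Y X' Y' where c: "c = (X, Y)" "d = (X', Y')" by fastforce
  have "X = X' \<and> Y' = Suc Y \<or> X = X' \<and> Y = Suc Y' \<or> Y = Y' \<and> X' = Suc X \<or> Y = Y' \<and> X = Suc X'"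
    using assms(1) c by auto
  then show "\<bar>fst (emb h I J p q c) - fst (emb h I J p q d)\<bar> = int (2 * h) \<and>
    \<bar>snd (emb h I J p q c) - snd (emb h I J p q d)\<bar> = 1 \<or>
    \<bar>fst (emb h I J p q c) - fst (emb h I J p q d)\<bar> = 1 \<and>
    \<bar>snd (emb h I J p q c) - snd (emb h I J p q d)\<bar> = int (2 * h)"
    by (elim disjE) (use abs_mod_2_Suc in \<open>auto simp: c emb_def algebra_simps\<close>)
qed (rule emb_in_board[OF assms(2,4,5)] emb_in_board[OF assms(3,4,5)])+

section \<open>Hamiltonian paths in small grids\<close>

text \<open>A chain leaves a row pair from its upper row, where \<open>(q + X) mod 2 = 1\<close>,
  and enters the next one in its lower row. So over \<open>I = 0\<close> the paths run from
  \<open>X = 0\<close> to \<open>X = 1\<close> for \<open>q = 0\<close>, and from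
  \<open>X = 1\<close> to \<open>X = 0\<close> for \<open>q = 1\<close>. In the 7 by 7 grids both
  ends have even coordinate sum, as the checkerboard colouring demands.\<close>

definition path_7_7_0 :: "(nat \<times> nat) list" where
  "path_7_7_0 =
    [(0,4), (1,4), (2,4), (3,4), (4,4), (5,4), (5,5), (4,5), (3,5), (2,5), (1,5), (0,5),
     (0,6), (1,6), (2,6), (3,6), (4,6), (5,6), (6,6), (6,5), (6,4), (6,3), (6,2), (5,2),
     (5,3), (4,3), (3,3), (2,3), (2,2), (3,2), (4,2), (4,1), (5,1), (6,1), (6,0), (5,0),
     (4,0), (3,0), (3,1), (2,1), (2,0), (1,0), (0,0), (0,1), (1,1), (1,2), (0,2), (0,3),
     (1,3)]"

definition path_7_7_1 :: "(nat \<times> nat) list" where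
  "path_7_7_1 =
    [(1,3), (2,3), (3,3), (4,3), (5,3), (5,2), (5,1), (4,1), (4,2), (3,2), (2,2), (1,2),
     (1,1), (0,1), (0,0), (1,0), (2,0), (2,1), (3,1), (3,0), (4,0), (5,0), (6,0), (6,1),
     (6,2), (6,3), (6,4), (6,5), (6,6), (5,6), (4,6), (3,6), (2,6), (1,6), (0,6), (0,5),
     (1,5), (2,5), (3,5), (4,5), (5,5), (5,4), (4,4), (3,4), (2,4), (1,4), (0,4), (0,3),
     (0,2)]"

definition path_7_6_0 :: "(nat \<times> nat) list" where
  "path_7_6_0 =
    [(0,3), (0,4), (0,5), (1,5), (2,5), (3,5), (4,5), (5,5), (6,5), (6,4), (5,4), (4,4),
     (4,3), (5,3), (6,3), (6,2), (5,2), (4,2), (4,1), (5,1), (6,1), (6,0), (5,0), (4,0),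
     (3,0), (2,0), (1,0), (0,0), (0,1), (0,2), (1,2), (1,1), (2,1), (3,1), (3,2), (2,2),
     (2,3), (3,3), (3,4), (2,4), (1,4), (1,3)]"

definition path_7_6_1 :: "(nat \<times> nat) list" where
  "path_7_6_1 =
    [(1,2), (2,2), (3,2), (4,2), (5,2), (5,1), (4,1), (3,1), (2,1), (1,1), (0,1), (0,0),
     (1,0), (2,0), (3,0), (4,0), (5,0), (6,0), (6,1), (6,2), (6,3), (6,4), (6,5), (5,5),
     (4,5), (3,5), (2,5), (1,5), (0,5), (0,4), (1,4), (2,4), (3,4), (4,4), (5,4), (5,3),
     (4,3), (3,3), (2,3), (1,3), (0,3), (0,2)]"

text \<open>The last cell (1, 2) is next to the first cell (1, 1), so this path and
  \<open>path_6_6\<close> close up to Hamiltonian cycles.\<close>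

definition path_6_7 :: "(nat \<times> nat) list" where
  "path_6_7 =
    [(1,1), (2,1), (3,1), (4,1), (5,1), (5,0), (4,0), (3,0), (2,0), (1,0), (0,0), (0,1),
     (0,2), (0,3), (1,3), (2,3), (3,3), (4,3), (4,4), (4,5), (3,5), (3,4), (2,4), (2,5),
     (1,5), (1,4), (0,4), (0,5), (0,6), (1,6), (2,6), (3,6), (4,6), (5,6), (5,5), (5,4),
     (5,3), (5,2), (4,2), (3,2), (2,2), (1,2)]"

definition path_6_6 :: "(nat \<times> nat) list" where
  "path_6_6 =
    [(1,1), (2,1), (3,1), (4,1), (5,1), (5,0), (4,0), (3,0), (2,0), (1,0), (0,0), (0,1),
     (0,2), (0,3), (1,3), (2,3), (3,3), (4,3), (4,4), (3,4), (2,4), (1,4), (0,4), (0,5),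
     (1,5), (2,5), (3,5), (4,5), (5,5), (5,4), (5,3), (5,2), (4,2), (3,2), (2,2), (1,2)]"

text \<open>Of the three prescribed edges, the corner one becomes a structured edge; the other two
  are those that the column switches trade.\<close>

definition good_path :: "nat \<Rightarrow> nat \<Rightarrow> (nat \<times> nat) list \<Rightarrow> bool" where
  "good_path m n xs \<longleftrightarrow> distinct xs \<and> set xs = {..<m} \<times> {..<n} \<and>
     list_all (\<lambda>(c, d). grid_adj c d) (zip xs (tl xs)) \<and>
     {{(0, 0), (1, 0)}, {(2, 2), (3, 2)}, {(2, 3), (3, 3)}} \<subseteq> path_edges xs"

lemma good_paths:
  "good_path 7 7 path_7_7_0" "good_path 7 7 path_7_7_1"
  "good_path 7 6 path_7_6_0" "good_path 7 6 path_7_6_1"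
  "good_path 6 7 path_6_7" "good_path 6 6 path_6_6"
  by code_simp+

definition grid_path :: "nat \<Rightarrow> nat \<Rightarrow> nat \<Rightarrow> (nat \<times> nat) list" where
  "grid_path I J q =
     (if I = 0 then
        if J = 0 then if q = 0 then path_7_7_0 else path_7_7_1
        else if q = 0 then path_7_6_0 else path_7_6_1
      else if J = 0 then path_6_7 else path_6_6)"

lemma good_grid_path:
  "good_path (if I = 0 then 7 else 6) (if J = 0 then 7 else 6) (grid_path I J q)"
  by (simp add: grid_path_def good_paths)

lemma distinct_grid_path: "distinct (grid_path I J q)"
  and set_grid_path: "set (grid_path I J q) = cells I J"
  and grid_path_common_edges:
    "{(0, 0), (1, 0)} \<in> path_edges (grid_path I J q)"
    "{(2, 2), (3, 2)} \<in> path_edges (grid_path I J q)"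
    "{(2, 3), (3, 3)} \<in> path_edges (grid_path I J q)"
  using good_grid_path[of I J q] unfolding good_path_def cells_def by simp_all

lemma length_grid_path: "3 \<le> length (grid_path I J q)"
proof -
  have "card (cells I J) \<ge> 3" unfolding cells_def by simp
  then show ?thesis by (metis set_grid_path distinct_card distinct_grid_path)
qed

lemma grid_path_adj:
  assumes "e \<in> path_edges (grid_path I J q)"
  shows "\<exists>c d. e = {c, d} \<and> c \<in> cells I J \<and> d \<in> cells I J \<and> grid_adj c d"
proof -
  have "list_all (\<lambda>(c, d). grid_adj c d) (zip (grid_path I J q) (tl (grid_path I J q)))"
    using good_grid_path[of I J q] unfolding good_path_def by simp
  from path_edges_successive[OF this assms] show ?thesis unfolding set_grid_path .
qed

text \<open>The edges traded by \<open>closing_switch\<close>. The first is used for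
  \<open>I = h - 1\<close>, which is 0 when \<open>h = 1\<close>, so it has to occur for every
  \<open>I\<close>.\<close>

lemma grid_path_link_edges:
  "{(4, 0), (5, 0)} \<in> path_edges (grid_path I 0 1)"
  "{(5, 1), (6, 1)} \<in> path_edges (grid_path 0 0 0)"
proof -
  have "{(4, 0), (5, 0)} \<in> path_edges path_7_7_1" "{(4, 0), (5, 0)} \<in> path_edges path_6_7"
    "{(5, 1), (6, 1)} \<in> path_edges path_7_7_0" by code_simp+
  then show "{(4, 0), (5, 0)} \<in> path_edges (grid_path I 0 1)"
    "{(5, 1), (6, 1)} \<in> path_edges (grid_path 0 0 0)" by (simp_all add: grid_path_def)
qed

lemma grid_path_closed: "I \<noteq> 0 \<Longrightarrow> grid_adj (last (grid_path I J q)) (hd (grid_path I J q))"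
  by (simp add: grid_path_def path_6_7_def path_6_6_def)

lemma hd_last_grid_path:
  "last (grid_path 0 J 0) = (1, 3)" "last (grid_path 0 J (Suc 0)) = (0, 2)"
  "hd (grid_path 0 J 0) = (0, if J = 0 then 4 else 3)"
  "hd (grid_path 0 J (Suc 0)) = (1, if J = 0 then 3 else 2)"
  by (simp_all add: grid_path_def path_7_7_0_def path_7_7_1_def path_7_6_0_def path_7_6_1_def)

section \<open>The cycle cover and its switches\<close>

abbreviation tour_edges :: "nat \<Rightarrow> (int \<times> int) set set" where
  "tour_edges h \<equiv> knight_edges (2 * h) (6 * (2 * h) + 2)"

definition inner_cycle :: "nat \<Rightarrow> nat \<Rightarrow> nat \<Rightarrow> nat \<Rightarrow> nat \<Rightarrow> (int \<times> int) list" where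
  "inner_cycle h I J p q = map (emb h I J p q) (grid_path I J q)"

text \<open>For \<open>I = J = 0\<close> the four grids have size \<open>7 \<times> 7\<close>, so they have no Hamiltonian
  cycles. Instead, for fixed \<open>q\<close>, the Hamiltonian paths of all grids with \<open>I = 0\<close> are
  chained by edges joining row pair \<open>J\<close> to row pair \<open>J + 1\<close>; stepping from \<open>J = h - 1\<close>
  to \<open>J = 0\<close> toggles \<open>p\<close>, so that the chain closes up after two rounds.\<close>

definition strip_block :: "nat \<Rightarrow> nat \<Rightarrow> nat \<Rightarrow> (int \<times> int) list" where
  "strip_block h q m = map (emb h 0 (m mod h) (m div h) q) (grid_path 0 (m mod h) q)"

definition strip_cycle :: "nat \<Rightarrow> nat \<Rightarrow> (int \<times> int) list" where
  "strip_cycle h q = concat (map (strip_block h q) [0..<2 * h])"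

definition cover :: "nat \<Rightarrow> (int \<times> int) list set" where
  "cover h = strip_cycle h ` {..<2} \<union>
     (\<lambda>(I, J, p, q). inner_cycle h I J p q) ` ({0<..<h} \<times> {..<h} \<times> {..<2} \<times> {..<2})"

section \<open>Edges, vertex sets and disjointness of the strip and inner cycles\<close>

lemma grid_path_nonempty: "grid_path I J q \<noteq> []"
  using length_grid_path[of I J q] by auto

lemma last_hd_in_cells: "last (grid_path I J q) \<in> cells I J" "hd (grid_path I J q) \<in> cells I J"
  using last_in_set[OF grid_path_nonempty] hd_in_set[OF grid_path_nonempty] set_grid_path
  by blast+

lemma distinct_emb_path:
  assumes "I < h" "J < h" "p < 2" "q < 2"
  shows "distinct (map (emb h I J p q) (grid_path I J q))"
  unfolding distinct_map using distinct_grid_path emb_eqD[OF _ assms(1,2,1,2,3,4,3,4)]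
  by (auto intro!: inj_onI)

lemma emb_path_edges:
  assumes "I < h" "J < h"
  shows "path_edges (map (emb h I J p q) (grid_path I J q)) \<subseteq> tour_edges h"
proof
  fix e assume "e \<in> path_edges (map (emb h I J p q) (grid_path I J q))"
  then obtain e' where e': "e' \<in> path_edges (grid_path I J q)" "e = emb h I J p q ` e'"
    unfolding path_edges_map by blast
  then obtain c d where "e' = {c, d}" "c \<in> cells I J" "d \<in> cells I J" "grid_adj c d"
    using grid_path_adj by blast
  then show "e \<in> tour_edges h" using emb_adj[of c d I J h p q] assms e' by simp
qed

lemma inner_cycle_edges:
  assumes "0 < I" "I < h" "J < h"
  shows "cycle_edges (inner_cycle h I J p q) \<subseteq> tour_edges h"
proof -
  have "{emb h I J p q (last (grid_path I J q)), emb h I J p q (hd (grid_path I J q))} \<in> tour_edges h"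
    using emb_adj[OF grid_path_closed last_hd_in_cells] assms by simp
  then show ?thesis unfolding inner_cycle_def
    using emb_path_edges[OF assms(2,3)] grid_path_nonempty
    by (simp add: cycle_edges_path_edges last_map hd_map)
qed

text \<open>The two cells lie in adjacent rows, one at \<open>X = 0\<close> and the other at
  \<open>X = 1\<close>, so the move is legal if the column bits \<open>(p + Y) mod 2\<close> agree.
  Between consecutive \<open>J\<close> the value of \<open>Y\<close> is unchanged and
  \<open>p\<close> stays. From \<open>J = h - 1\<close> to \<open>J = 0\<close> it grows by one,
  which forces \<open>p\<close> to toggle.\<close>

lemma strip_link:
  assumes "J < h" "p < 2" "q < 2"
  shows "Suc J < h \<Longrightarrow> {emb h 0 J p q (last (grid_path 0 J q)),
      emb h 0 (Suc J) p q (hd (grid_path 0 (Suc J) q))} \<in> tour_edges h"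
    and "Suc J = h \<Longrightarrow> {emb h 0 J p q (last (grid_path 0 J q)),
      emb h 0 0 (1 - p) q (hd (grid_path 0 0 q))} \<in> tour_edges h"
proof -
  have pq: "p = 0 \<or> p = 1" "q = 0 \<or> q = 1" using assms by auto
  show "{emb h 0 J p q (last (grid_path 0 J q)),
      emb h 0 (Suc J) p q (hd (grid_path 0 (Suc J) q))} \<in> tour_edges h" if "Suc J < h"
  proof (rule knight_edgeI)
    show "emb h 0 J p q (last (grid_path 0 J q)) \<in> board (6 * (2 * h) + 2)"
      "emb h 0 (Suc J) p q (hd (grid_path 0 (Suc J) q)) \<in> board (6 * (2 * h) + 2)"
      using emb_in_board[OF last_hd_in_cells(1)] emb_in_board[OF last_hd_in_cells(2)] that by simp_all
  qed (use pq in \<open>auto simp: hd_last_grid_path emb_def algebra_simps\<close>)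
  show "{emb h 0 J p q (last (grid_path 0 J q)),
      emb h 0 0 (1 - p) q (hd (grid_path 0 0 q))} \<in> tour_edges h" if "Suc J = h"
  proof (rule knight_edgeI)
    show "emb h 0 J p q (last (grid_path 0 J q)) \<in> board (6 * (2 * h) + 2)"
      "emb h 0 0 (1 - p) q (hd (grid_path 0 0 q)) \<in> board (6 * (2 * h) + 2)"
      using emb_in_board[OF last_hd_in_cells(1)] emb_in_board[OF last_hd_in_cells(2)] that by simp_all
  qed (use pq that in \<open>auto simp: hd_last_grid_path emb_def algebra_simps\<close>)
qed

lemma strip_block_link:
  assumes "m < 2 * h" "q < 2"
  shows "{last (strip_block h q m), hd (strip_block h q (Suc m mod (2 * h)))} \<in> tour_edges h"
proof -
  define J p where "J = m mod h" and "p = m div h"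
  have J: "J < h" and p: "p < 2" and m: "m = h * p + J"
    using assms unfolding J_def p_def by (auto simp: less_mult_imp_div_less mult.commute)
  have "(Suc m mod (2 * h)) mod h = Suc J \<and> (Suc m mod (2 * h)) div h = p" if "Suc J < h"
  proof -
    have "Suc m = Suc J + h * p" using m by simp
    then have *: "Suc m mod h = Suc J" "Suc m div h = p"
      using that by (simp_all only: mod_mult_self2 div_mult_self2) simp_all
    have "h * p \<le> h * 1" using p by (intro mult_le_mono) auto
    then have "Suc m < 2 * h" using m that by linarith
    then show ?thesis using * by simp
  qed
  \<comment> \<open>The next index is \<open>h\<close> if \<open>p = 0\<close> and wraps around to 0
    if \<open>p = 1\<close>; both times the quotient by \<open>h\<close> becomes
    \<open>1 - p\<close>.\<close>
  moreover have "(Suc m mod (2 * h)) mod h = 0 \<and> (Suc m mod (2 * h)) div h = 1 - p" if "Suc J = h"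
  proof -
    have "Suc m = h * Suc p" using m that by simp
    moreover have "p = 0 \<or> p = 1" using p by auto
    ultimately have "Suc m = h \<and> p = 0 \<or> Suc m = 2 * h \<and> p = 1" by auto
    then show ?thesis using J by auto
  qed
  ultimately show ?thesis
    using strip_link[OF J p assms(2)] J unfolding strip_block_def
    by (cases "Suc J < h") (auto simp: last_map hd_map grid_path_nonempty J_def[symmetric] p_def[symmetric])
qed

lemma strip_cycle_edges:
  assumes "0 < h" "q < 2"
  shows "cycle_edges (strip_cycle h q) \<subseteq> tour_edges h"
proof -
  have ne: "strip_block h q m \<noteq> []" for m
    unfolding strip_block_def using grid_path_nonempty by simp
  have "path_edges (strip_cycle h q) \<subseteq> tour_edges h"
    unfolding strip_cycle_def
  proof (rule path_edges_concat_subset)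
    show "strip_block h q k \<noteq> [] \<and> path_edges (strip_block h q k) \<subseteq> tour_edges h" for k
      using ne emb_path_edges[of 0 h "k mod h"] assms unfolding strip_block_def by simp
    show "{last (strip_block h q k), hd (strip_block h q (Suc k))} \<in> tour_edges h" if "Suc k < 2 * h" for k
      using strip_block_link[of k h q] assms that by simp
  qed
  moreover have "{last (strip_cycle h q), hd (strip_cycle h q)} \<in> tour_edges h"
  proof -
    obtain n where n: "2 * h = Suc n" using assms by (cases "2 * h") auto
    have "last (strip_cycle h q) = last (strip_block h q n)"
      unfolding strip_cycle_def n using last_concat_upt ne by blast
    moreover have "hd (strip_cycle h q) = hd (strip_block h q 0)"
      unfolding strip_cycle_def by (rule hd_concat_upt[OF ne]) (use assms in simp)
    ultimately show ?thesis using strip_block_link[of n h q] assms n by simp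
  qed
  moreover have "strip_cycle h q \<noteq> []"
    unfolding strip_cycle_def using ne assms by (simp add: upt_conv_Cons)
  ultimately show ?thesis by (simp add: cycle_edges_path_edges)
qed

lemma set_inner_cycle: "set (inner_cycle h I J p q) = emb h I J p q ` cells I J"
  unfolding inner_cycle_def by (simp add: set_grid_path)

lemma set_strip_block: "set (strip_block h q m) = emb h 0 (m mod h) (m div h) q ` cells 0 (m mod h)"
  unfolding strip_block_def by (simp add: set_grid_path)

lemma set_strip_cycle:
  assumes "0 < h"
  shows "set (strip_cycle h q) = {emb h 0 J p q c | J p c. J < h \<and> p < 2 \<and> c \<in> cells 0 J}"
proof (intro set_eqI iffI)
  fix v assume "v \<in> set (strip_cycle h q)"
  then obtain m where "m < 2 * h" "v \<in> emb h 0 (m mod h) (m div h) q ` cells 0 (m mod h)"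
    unfolding strip_cycle_def by (auto simp: set_strip_block)
  moreover have "m mod h < h" "m div h < 2"
    using assms \<open>m < 2 * h\<close> by (simp_all add: less_mult_imp_div_less)
  ultimately show "v \<in> {emb h 0 J p q c | J p c. J < h \<and> p < 2 \<and> c \<in> cells 0 J}" by blast
next
  fix v assume "v \<in> {emb h 0 J p q c | J p c. J < h \<and> p < 2 \<and> c \<in> cells 0 J}"
  then obtain J p c where v: "v = emb h 0 J p q c" "J < h" "p < 2" "c \<in> cells 0 J" by blast
  have "h * p \<le> h * 1" using v by (intro mult_le_mono) auto
  then have "J + h * p < 2 * h" using v by linarith
  moreover have "v \<in> set (strip_block h q (J + h * p))"
    using v by (simp add: set_strip_block)
  ultimately show "v \<in> set (strip_cycle h q)" unfolding strip_cycle_def by auto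
qed

lemma distinct_strip_cycle:
  assumes "0 < h" "q < 2"
  shows "distinct (strip_cycle h q)"
  unfolding strip_cycle_def
proof (rule distinct_concat_upt)
  have b: "k mod h < h" "k div h < 2" if "k < 2 * h" for k
    using assms that by (simp_all add: less_mult_imp_div_less)
  show "distinct (strip_block h q k)" if "k < 2 * h" for k
    unfolding strip_block_def using distinct_emb_path b[OF that] assms by blast
  show "set (strip_block h q j) \<inter> set (strip_block h q k) = {}"
    if jk: "j < 2 * h" "k < 2 * h" "j \<noteq> k" for j k
  proof (rule ccontr)
    assume "\<not> ?thesis"
    then obtain c d where "emb h 0 (j mod h) (j div h) q c = emb h 0 (k mod h) (k div h) q d"
      unfolding set_strip_block by blast
    then have "j mod h = k mod h" "j div h = k div h"
      using emb_eqD b[OF jk(1)] b[OF jk(2)] assms by blast+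
    then show False using jk(3) by (metis div_mult_mod_eq)
  qed
qed

lemma length_strip_cycle:
  assumes "0 < h"
  shows "3 \<le> length (strip_cycle h q)"
proof -
  have "length (strip_block h q 0) \<le> length (strip_cycle h q)"
    unfolding strip_cycle_def using assms by (simp add: upt_conv_Cons)
  then show ?thesis using length_grid_path[of 0 0 q] unfolding strip_block_def by simp
qed

lemma cover_cases:
  assumes "x \<in> cover h"
  obtains q where "q < 2" "x = strip_cycle h q"
  | I J p q where "0 < I" "I < h" "J < h" "p < 2" "q < 2" "x = inner_cycle h I J p q"
  using assms unfolding cover_def by auto

text \<open>Indexes the cover by grids, so that both kinds of cycles are treated alike. For
  \<open>I = 0\<close> the labels \<open>J\<close> and \<open>p\<close> are ignored, because one
  strip cycle runs through all of these grids.\<close>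

definition cycle_of :: "nat \<Rightarrow> nat \<Rightarrow> nat \<Rightarrow> nat \<Rightarrow> nat \<Rightarrow> (int \<times> int) list" where
  "cycle_of h I J p q = (if I = 0 then strip_cycle h q else inner_cycle h I J p q)"

lemma cycle_of_in_cover:
  assumes "I < h" "J < h" "p < 2" "q < 2"
  shows "cycle_of h I J p q \<in> cover h"
  using assms unfolding cycle_of_def cover_def by force

lemma emb_in_cycle_of:
  assumes "I < h" "J < h" "p < 2" "q < 2" "c \<in> cells I J"
  shows "emb h I J p q c \<in> set (cycle_of h I J p q)"
proof (cases "I = 0")
  case True
  have "emb h 0 J p q c \<in> {emb h 0 J p q c | J p c. J < h \<and> p < 2 \<and> c \<in> cells 0 J}"
    using assms True by blast
  then have "emb h 0 J p q c \<in> set (strip_cycle h q)"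
    using set_strip_cycle[of h q] assms by simp
  then show ?thesis using True unfolding cycle_of_def by simp
next
  case False
  then show ?thesis using assms unfolding cycle_of_def by (simp add: set_inner_cycle)
qed

lemma in_cover_emb:
  assumes "x \<in> cover h" "v \<in> set x" "0 < h"
  obtains I J p q c where "v = emb h I J p q c" "I < h" "J < h" "p < 2" "q < 2" "c \<in> cells I J"
    "x = cycle_of h I J p q"
  using assms(1)
proof (cases rule: cover_cases)
  case (1 q)
  then obtain J p c where "v = emb h 0 J p q c" "J < h" "p < 2" "c \<in> cells 0 J"
    using assms by (auto simp: set_strip_cycle)
  then show ?thesis using that[of 0 J p q c] 1 assms unfolding cycle_of_def by simp
next
  case (2 I J p q)
  then obtain c where "v = emb h I J p q c" "c \<in> cells I J"
    using assms by (auto simp: set_inner_cycle)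
  then show ?thesis using that[of I J p q c] 2 unfolding cycle_of_def by simp
qed

text \<open>Disjointness: a vertex determines the labels of its grid by \<open>emb_eqD\<close>, and
  these determine its cycle through \<open>cycle_of\<close>.\<close>

lemma cycle_cover_cover:
  assumes "0 < h"
  shows "cycle_cover (board (6 * (2 * h) + 2)) (tour_edges h) (cover h)"
  unfolding cycle_cover_def
proof (intro conjI ballI impI)
  show "finite (cover h)" unfolding cover_def by simp
  fix x assume x: "x \<in> cover h"
  then show "3 \<le> length x"
    by (cases rule: cover_cases)
      (use assms length_strip_cycle length_grid_path in \<open>simp_all add: inner_cycle_def\<close>)
  show "distinct x" using x
    by (cases rule: cover_cases)
      (use assms distinct_strip_cycle distinct_emb_path in \<open>simp_all add: inner_cycle_def\<close>)
  show "cycle_edges x \<subseteq> tour_edges h" using x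
    by (cases rule: cover_cases) (use assms strip_cycle_edges inner_cycle_edges in simp_all)
  fix y assume y: "y \<in> cover h" "x \<noteq> y"
  show "set x \<inter> set y = {}"
  proof (rule ccontr)
    assume "set x \<inter> set y \<noteq> {}"
    then obtain v where v: "v \<in> set x" "v \<in> set y" by blast
    obtain I J p q c where 1: "v = emb h I J p q c" "I < h" "J < h" "p < 2" "q < 2"
      "x = cycle_of h I J p q" using in_cover_emb[OF x v(1) assms] by metis
    obtain I' J' p' q' c' where 2: "v = emb h I' J' p' q' c'" "I' < h" "J' < h" "p' < 2" "q' < 2"
      "y = cycle_of h I' J' p' q'" using in_cover_emb[OF y(1) v(2) assms] by metis
    have "emb h I J p q c = emb h I' J' p' q' c'" using 1 2 by simp
    from emb_eqD[OF this] have "x = y" using 1 2 by simp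
    then show False using y(2) by simp
  qed
next
  show "\<Union> (set ` cover h) = board (6 * (2 * h) + 2)"
  proof (intro set_eqI iffI)
    fix v assume "v \<in> \<Union> (set ` cover h)"
    then obtain x where x: "x \<in> cover h" "v \<in> set x" by blast
    show "v \<in> board (6 * (2 * h) + 2)"
      using in_cover_emb[OF x assms] emb_in_board by metis
  next
    fix v assume "v \<in> board (6 * (2 * h) + 2)"
    then obtain I J p q c where "v = emb h I J p q c" "I < h" "J < h" "p < 2" "q < 2" "c \<in> cells I J"
      using board_cases assms by metis
    then have "v \<in> set (cycle_of h I J p q)" "cycle_of h I J p q \<in> cover h"
      using emb_in_cycle_of cycle_of_in_cover by simp_all
    then show "v \<in> \<Union> (set ` cover h)" by auto
  qed
qed

lemma grid_edge_in_cover: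
  assumes "{c, d} \<in> path_edges (grid_path I J q)" "I < h" "J < h" "p < 2" "q < 2"
  shows "{emb h I J p q c, emb h I J p q d} \<in> \<Union> (cycle_edges ` cover h)"
proof -
  have e: "{emb h I J p q c, emb h I J p q d} \<in> path_edges (map (emb h I J p q) (grid_path I J q))"
    unfolding path_edges_map using assms(1) by (rule rev_image_eqI) simp
  have "path_edges (map (emb h I J p q) (grid_path I J q)) \<subseteq> path_edges (cycle_of h I J p q)"
  proof (cases "I = 0")
    case True
    \<comment> \<open>The grid with labels \<open>J\<close> and \<open>p\<close> is block number
      \<open>J + h * p\<close> of the strip cycle.\<close>
    have "h * p \<le> h * 1" using assms by (intro mult_le_mono) auto
    then have "J + h * p < 2 * h" using assms by linarith
    moreover have "strip_block h q (J + h * p) = map (emb h I J p q) (grid_path I J q)"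
      unfolding strip_block_def using assms True by simp
    ultimately have "map (emb h I J p q) (grid_path I J q) \<in> set (map (strip_block h q) [0..<2 * h])"
      by (metis atLeastLessThan_iff image_eqI le0 set_map set_upt)
    from path_edges_subset_concat[OF this] show ?thesis
      by (simp add: True cycle_of_def strip_cycle_def)
  qed (simp add: cycle_of_def inner_cycle_def)
  moreover have "cycle_of h I J p q \<noteq> []" using e calculation by (cases "cycle_of h I J p q") auto
  ultimately have "{emb h I J p q c, emb h I J p q d} \<in> cycle_edges (cycle_of h I J p q)"
    using e by (auto simp: cycle_edges_path_edges)
  then show ?thesis using cycle_of_in_cover[OF assms(2-5)] by blast
qed

text \<open>The cells \<open>(2, 2), (3, 2), (2, 3), (3, 3)\<close> host all switches between column pairs \<open>I\<close> and
  \<open>I + 1\<close>; the row is chosen so that the switch leaves from the right column of pair \<open>I\<close>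
  and arrives in the left column of pair \<open>I + 1\<close>.\<close>

definition column_switch where
  "column_switch h I J p q =
     (emb h I J p q (2, 3 - p), emb h I J p q (3, 3 - p),
      emb h (Suc I) J p q (2, 2 + p), emb h (Suc I) J p q (3, 2 + p))"

text \<open>Going around all column pairs toggles \<open>q\<close>, so this switch connects the two strip cycles.\<close>

definition closing_switch where
  "closing_switch h =
     (emb h (h - 1) 0 1 1 (4, 0), emb h (h - 1) 0 1 1 (5, 0),
      emb h 0 0 1 0 (5, 1), emb h 0 0 1 0 (6, 1))"

text \<open>For fixed \<open>q\<close> the column switches attach each inner cycle to the one before
  it, forming a tree rooted at \<open>strip_cycle h q\<close>; the closing switch joins the two
  trees.\<close>

definition tour_switches where
  "tour_switches h = insert (closing_switch h)
     {column_switch h I J p q | I J p q. Suc I < h \<and> J < h \<and> p < 2 \<and> q < 2}"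

text \<open>The sum of \<open>p\<close> and \<open>3 - p\<close> is odd and that of \<open>p\<close>
  and \<open>2 + p\<close> even, so the first coordinates differ by 1. As \<open>3 - p\<close> and
  \<open>2 + p\<close> also differ by 1, the second coordinates differ by
  \<open>2 * h\<close>.\<close>

lemma emb_cross_adj:
  assumes "Suc I < h" "J < h" "p < 2" "q < 2" "X = 2 \<or> X = 3"
  shows "{emb h I J p q (X, 3 - p), emb h (Suc I) J p q (X, 2 + p)} \<in> tour_edges h"
proof (rule knight_edgeI)
  show "emb h I J p q (X, 3 - p) \<in> board (6 * (2 * h) + 2)"
    "emb h (Suc I) J p q (X, 2 + p) \<in> board (6 * (2 * h) + 2)"
    by (rule emb_in_board; use assms in \<open>auto simp: cells_def\<close>)+
  have "p = 0 \<or> p = 1" using assms by auto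
  then show "\<bar>fst (emb h I J p q (X, 3 - p)) - fst (emb h (Suc I) J p q (X, 2 + p))\<bar> = int (2 * h) \<and>
    \<bar>snd (emb h I J p q (X, 3 - p)) - snd (emb h (Suc I) J p q (X, 2 + p))\<bar> = 1 \<or>
    \<bar>fst (emb h I J p q (X, 3 - p)) - fst (emb h (Suc I) J p q (X, 2 + p))\<bar> = 1 \<and>
    \<bar>snd (emb h I J p q (X, 3 - p)) - snd (emb h (Suc I) J p q (X, 2 + p))\<bar> = int (2 * h)"
    by (auto simp: emb_def algebra_simps)
qed

text \<open>The right column of pair \<open>h - 1\<close> borders the left column of pair 0 in the
  next copy, so \<open>X\<close> grows by one. Keeping the row bit \<open>(q + X) mod 2\<close> then
  turns \<open>q = 1\<close> into \<open>q = 0\<close>.\<close>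

lemma closing_adj:
  assumes "0 < h"
  shows "{emb h (h - 1) 0 1 1 (4, 0), emb h 0 0 1 0 (5, 1)} \<in> tour_edges h"
    "{emb h (h - 1) 0 1 1 (5, 0), emb h 0 0 1 0 (6, 1)} \<in> tour_edges h"
proof -
  obtain n where n: "h = Suc n" using assms by (cases h) auto
  have board: "emb h (h - 1) 0 1 1 (4, 0) \<in> board (6 * (2 * h) + 2)"
    "emb h (h - 1) 0 1 1 (5, 0) \<in> board (6 * (2 * h) + 2)"
    "emb h 0 0 1 0 (5, 1) \<in> board (6 * (2 * h) + 2)"
    "emb h 0 0 1 0 (6, 1) \<in> board (6 * (2 * h) + 2)"
    by (rule emb_in_board; use assms in \<open>simp add: cells_def\<close>)+
  show "{emb h (h - 1) 0 1 1 (4, 0), emb h 0 0 1 0 (5, 1)} \<in> tour_edges h"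
    by (rule knight_edgeI[OF board(1,3)]) (simp add: n emb_def)
  show "{emb h (h - 1) 0 1 1 (5, 0), emb h 0 0 1 0 (6, 1)} \<in> tour_edges h"
    by (rule knight_edgeI[OF board(2,4)]) (simp add: n emb_def)
qed

section \<open>Pairwise disjointness of the switches\<close>

lemma switch_verts_column:
  assumes "v \<in> switch_verts (column_switch h I J p q)"
  obtains K X where "v = emb h K J p q (X, if K = I then 3 - p else 2 + p)"
    "X = 2 \<or> X = 3" "K = I \<or> K = Suc I"
proof -
  consider "v = emb h I J p q (2, 3 - p)" | "v = emb h I J p q (3, 3 - p)"
    | "v = emb h (Suc I) J p q (2, 2 + p)" | "v = emb h (Suc I) J p q (3, 2 + p)"
    using assms unfolding column_switch_def by auto
  then show ?thesis
    by cases (use that[of I 2] that[of I 3] that[of "Suc I" 2] that[of "Suc I" 3] in simp_all)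
qed

lemma switch_verts_closing:
  assumes "v \<in> switch_verts (closing_switch h)"
  obtains I q X Y where "v = emb h I 0 1 q (X, Y)" "I = 0 \<or> I = h - 1" "q < 2" "X \<ge> 4"
proof -
  consider "v = emb h (h - 1) 0 1 1 (4, 0)" | "v = emb h (h - 1) 0 1 1 (5, 0)"
    | "v = emb h 0 0 1 0 (5, 1)" | "v = emb h 0 0 1 0 (6, 1)"
    using assms unfolding closing_switch_def by auto
  then show ?thesis
    by cases (use that[of "h - 1" 1 4] that[of "h - 1" 1 5] that[of 0 0 5] that[of 0 0 6] in simp_all)
qed

text \<open>The closing switch uses cells with \<open>X\<close> >= 4, the column switches only
  \<open>X = 2\<close> and \<open>X = 3\<close>.\<close>

lemma closing_column_disjoint:
  assumes "Suc I < h" "J < h" "p < 2" "q < 2"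
  shows "switch_verts (closing_switch h) \<inter> switch_verts (column_switch h I J p q) = {}"
proof (rule ccontr)
  assume "\<not> ?thesis"
  then obtain v where v: "v \<in> switch_verts (closing_switch h)"
    "v \<in> switch_verts (column_switch h I J p q)" by blast
  obtain I' q' X' Y' where 1: "v = emb h I' 0 1 q' (X', Y')" "I' = 0 \<or> I' = h - 1" "q' < 2" "X' \<ge> 4"
    by (rule switch_verts_closing[OF v(1)])
  obtain K X where 2: "v = emb h K J p q (X, if K = I then 3 - p else 2 + p)"
    "X = 2 \<or> X = 3" "K = I \<or> K = Suc I"
    by (rule switch_verts_column[OF v(2)])
  have "emb h I' 0 1 q' (X', Y') = emb h K J p q (X, if K = I then 3 - p else 2 + p)"
    using 1 2 by simp
  from emb_eqD[OF this] have "X' = X" using 1(2,3) 2(3) assms by auto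
  then show False using 1 2 by auto
qed

text \<open>A grid over column pair \<open>K\<close> meets at most two column switches: the one
  leaving it uses \<open>Y = 3 - p\<close>, the one arriving uses \<open>Y = 2 + p\<close>, and
  these differ.\<close>

lemma column_column_disjoint:
  assumes "Suc I < h" "J < h" "p < 2" "q < 2" "Suc I' < h" "J' < h" "p' < 2" "q' < 2"
    and ne: "column_switch h I J p q \<noteq> column_switch h I' J' p' q'"
  shows "switch_verts (column_switch h I J p q) \<inter> switch_verts (column_switch h I' J' p' q') = {}"
proof (rule ccontr)
  assume "\<not> ?thesis"
  then obtain v where v: "v \<in> switch_verts (column_switch h I J p q)"
    "v \<in> switch_verts (column_switch h I' J' p' q')" by blast
  obtain K X where 1: "v = emb h K J p q (X, if K = I then 3 - p else 2 + p)"
    "X = 2 \<or> X = 3" "K = I \<or> K = Suc I"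
    by (rule switch_verts_column[OF v(1)])
  obtain K' X' where 2: "v = emb h K' J' p' q' (X', if K' = I' then 3 - p' else 2 + p')"
    "X' = 2 \<or> X' = 3" "K' = I' \<or> K' = Suc I'"
    by (rule switch_verts_column[OF v(2)])
  have "emb h K J p q (X, if K = I then 3 - p else 2 + p) =
    emb h K' J' p' q' (X', if K' = I' then 3 - p' else 2 + p')" using 1 2 by simp
  from emb_eqD[OF this] have eq: "K = K'" "J = J'" "p = p'" "q = q'"
    and Y: "(if K = I then 3 - p else 2 + p) = (if K' = I' then 3 - p' else 2 + p')"
    using 1(3) 2(3) assms by auto
  have "3 - p \<noteq> 2 + p" using assms(3) by presburger
  then have "K = I \<longleftrightarrow> K' = I'" using Y eq by (auto split: if_splits)
  then have "I = I'" using 1(3) 2(3) eq by auto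
  then show False using ne eq by simp
qed

lemma switches_tour_switches:
  assumes "0 < h"
  shows "switches (tour_edges h) (\<Union> (cycle_edges ` cover h)) (tour_switches h)"
  unfolding switches_def
proof (intro conjI ballI impI)
  have cases: "r = closing_switch h \<or> (\<exists>I J p q. r = column_switch h I J p q \<and>
      Suc I < h \<and> J < h \<and> p < 2 \<and> q < 2)" if "r \<in> tour_switches h" for r
    using that unfolding tour_switches_def by blast
  fix s assume s: "s \<in> tour_switches h"
  let ?U = "\<Union> (cycle_edges ` cover h)"
  have "case column_switch h I J p q of (u, v, w, z) \<Rightarrow>
      {u, v} \<in> ?U \<and> {w, z} \<in> ?U \<and> {u, w} \<in> tour_edges h \<and> {v, z} \<in> tour_edges h"
    if *: "Suc I < h" "J < h" "p < 2" "q < 2" for I J p q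
  proof -
    \<comment> \<open>The two values of \<open>Y\<close> are 2 and 3 in some order, so the traded
      edges are among those common to all grid paths.\<close>
    have "3 - p = 3 \<and> 2 + p = 2 \<or> 3 - p = 2 \<and> 2 + p = 3" using * by auto
    then have e: "{(2, 3 - p), (3, 3 - p)} \<in> path_edges (grid_path I J q)"
      "{(2, 2 + p), (3, 2 + p)} \<in> path_edges (grid_path (Suc I) J q)"
      by (elim disjE conjE; simp only: grid_path_common_edges)+
    show ?thesis unfolding column_switch_def prod.case
      by (intro conjI grid_edge_in_cover[OF e(1)] grid_edge_in_cover[OF e(2)] emb_cross_adj)
        (use * in simp_all)
  qed
  moreover have "case closing_switch h of (u, v, w, z) \<Rightarrow>
      {u, v} \<in> ?U \<and> {w, z} \<in> ?U \<and> {u, w} \<in> tour_edges h \<and> {v, z} \<in> tour_edges h"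
    unfolding closing_switch_def prod.case
    using grid_edge_in_cover[OF grid_path_link_edges(1)] grid_edge_in_cover[OF grid_path_link_edges(2)]
      closing_adj assms by (intro conjI) simp_all
  ultimately show "case s of (u, v, w, z) \<Rightarrow>
      {u, v} \<in> ?U \<and> {w, z} \<in> ?U \<and> {u, w} \<in> tour_edges h \<and> {v, z} \<in> tour_edges h"
    using cases[OF s] by (elim disjE exE conjE) (simp_all only:)
  fix t assume t: "t \<in> tour_switches h" "s \<noteq> t"
  show "switch_verts s \<inter> switch_verts t = {}"
    using cases[OF s] cases[OF t(1)]
  proof (elim disjE exE conjE)
    fix I J p q
    assume "s = closing_switch h" "t = column_switch h I J p q" "Suc I < h" "J < h" "p < 2" "q < 2"
    then show ?thesis using closing_column_disjoint by simp
  next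
    fix I J p q
    assume "t = closing_switch h" "s = column_switch h I J p q" "Suc I < h" "J < h" "p < 2" "q < 2"
    then show ?thesis using closing_column_disjoint[of I h J p q] by (simp add: Int_commute)
  next
    fix I J p q I' J' p' q'
    assume "s = column_switch h I J p q" "Suc I < h" "J < h" "p < 2" "q < 2"
      "t = column_switch h I' J' p' q'" "Suc I' < h" "J' < h" "p' < 2" "q' < 2"
    then show ?thesis using column_column_disjoint[of I h J p q I' J' p' q'] t(2) by simp
  qed (use t(2) in simp)
qed

text \<open>Induction on \<open>I\<close> along the column switches shows that membership in
  \<open>P\<close> depends on \<open>q\<close> alone; the closing switch then identifies
  \<open>q = 0\<close> with \<open>q = 1\<close>.\<close>

lemma cover_connected:
  assumes "0 < h"
    and P: "\<And>x. x \<in> cover h \<Longrightarrow> set x \<subseteq> P \<or> set x \<inter> P = {}"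
    and S: "\<And>u v w z. (u, v, w, z) \<in> tour_switches h \<Longrightarrow> u \<in> P \<longleftrightarrow> w \<in> P"
  shows "board (6 * (2 * h) + 2) \<inter> P = {} \<or> board (6 * (2 * h) + 2) \<subseteq> P"
proof -
  define A where "A q \<longleftrightarrow> emb h 0 0 0 q (0, 0) \<in> P" for q
  have same: "emb h I J p q c \<in> P \<longleftrightarrow> emb h I J' p' q d \<in> P"
    if "I < h" "J < h" "p < 2" "q < 2" "c \<in> cells I J" "J' < h" "p' < 2" "d \<in> cells I J'"
      "cycle_of h I J p q = cycle_of h I J' p' q" for I J p q c J' p' d
    using emb_in_cycle_of[OF that(1-5)] emb_in_cycle_of[OF that(1,6,7,4,8)]
      P[OF cycle_of_in_cover[OF that(1-4)]] that(9) by auto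
  have A: "emb h I J p q c \<in> P \<longleftrightarrow> A q"
    if "I < h" "J < h" "p < 2" "q < 2" "c \<in> cells I J" for I J p q c
    using that
  proof (induction I arbitrary: c)
    case 0
    then show ?case unfolding A_def
      by (intro same) (simp_all add: cells_def cycle_of_def)
  next
    case (Suc I)
    have mem: "(2, 3 - p) \<in> cells I J" "(2, 2 + p) \<in> cells (Suc I) J"
      using Suc.prems by (auto simp: cells_def)
    have "emb h (Suc I) J p q c \<in> P \<longleftrightarrow> emb h (Suc I) J p q (2, 2 + p) \<in> P"
      using Suc.prems mem by (intro same) simp_all
    also have "\<dots> \<longleftrightarrow> emb h I J p q (2, 3 - p) \<in> P"
      using S[of "emb h I J p q (2, 3 - p)" "emb h I J p q (3, 3 - p)"
          "emb h (Suc I) J p q (2, 2 + p)" "emb h (Suc I) J p q (3, 2 + p)"] Suc.prems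
      unfolding tour_switches_def column_switch_def by blast
    also have "\<dots> \<longleftrightarrow> A q" using Suc mem by simp
    finally show ?case .
  qed
  have "A 1 \<longleftrightarrow> emb h (h - 1) 0 1 1 (4, 0) \<in> P"
    using A[of "h - 1" 0 1 1 "(4, 0)"] assms(1) by (simp add: cells_def)
  also have "\<dots> \<longleftrightarrow> emb h 0 0 1 0 (5, 1) \<in> P"
    by (rule S) (auto simp: tour_switches_def closing_switch_def)
  also have "\<dots> \<longleftrightarrow> A 0"
    using A[of 0 0 1 0 "(5, 1)"] assms(1) by (simp add: cells_def)
  finally have "A q \<longleftrightarrow> A 0" if "q < 2" for q
    using that by (cases "q = 0") (auto simp: less_2_cases_iff)
  then have "v \<in> P \<longleftrightarrow> A 0" if "v \<in> board (6 * (2 * h) + 2)" for v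
    using board_cases[OF that assms(1)] A by metis
  then show ?thesis by blast
qed

text \<open>Halving \<open>i\<close> and \<open>j\<close> gives the pairs, their parities give
  \<open>p\<close> and \<open>q\<close>. Adding \<open>(- 1) ^ j\<close> to \<open>j\<close> is
  exactly the toggle inside its pair.\<close>

lemma structured_edge_emb:
  "{(int i, int j), (int i + int (2 * h), int j + (- 1) ^ j)} =
   {emb h (i div 2) (j div 2) (i mod 2) (j mod 2) (0, 0), emb h (i div 2) (j div 2) (i mod 2) (j mod 2) (1, 0)}"
proof -
  have split: "2 * int (n div 2) + int (n mod 2) = int n" for n
    by (metis of_nat_add of_nat_mult mult_div_mod_eq of_nat_numeral)
  have "int j + (- 1) ^ j = 2 * int (j div 2) + int (Suc (j mod 2) mod 2)"
    by (cases "even j") (auto elim!: evenE oddE)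
  moreover have x: "2 * int h + 2 * int (i div 2) + int (i mod 2) = int i + 2 * int h"
    using split[of i] by simp
  ultimately show ?thesis unfolding emb_def by (simp add: split x)
qed

theorem theorem9:
  fixes a :: nat
  assumes "even a" and "a > 0"
  shows "\<exists>vs. knight_tour a (6 * a + 2) vs \<and> structured a vs"
proof -
  obtain h where a: "a = 2 * h" and h: "0 < h" using assms by (auto elim!: evenE)
  define K where "K = {{emb h I J p q (0, 0), emb h I J p q (1, 0)} | I J p q.
    I < h \<and> J < h \<and> p < 2 \<and> q < 2}"
  have "\<exists>vs. hamiltonian_cycle (board (6 * (2 * h) + 2)) (tour_edges h) vs \<and> K \<subseteq> cycle_edges vs"
  proof (rule hamiltonian_cycle_from_switches[OF cycle_cover_cover[OF h] _ switches_tour_switches[OF h]])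
    show "cover h \<noteq> {}" using cycle_of_in_cover[of 0 h 0 0 0] h by auto
    show "K \<subseteq> \<Union> (cycle_edges ` cover h)"
      unfolding K_def using grid_edge_in_cover[OF grid_path_common_edges(1)] by blast
    \<comment> \<open>Corner edges lie at \<open>X\<close> < 2 and all switches at \<open>X\<close>
      >= 2, so injectivity of \<open>emb\<close> keeps them apart.\<close>
    show "e \<inter> switch_verts s = {}" if "e \<in> K" "s \<in> tour_switches h" for e s
    proof (rule ccontr)
      assume "\<not> ?thesis"
      then obtain v where v: "v \<in> e" "v \<in> switch_verts s" by blast
      obtain I J p q X where 1: "v = emb h I J p q (X, 0)" "I < h" "J < h" "p < 2" "q < 2" "X < 2"
      proof -
        obtain I J p q where "e = {emb h I J p q (0, 0), emb h I J p q (1, 0)}"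
          "I < h" "J < h" "p < 2" "q < 2" using \<open>e \<in> K\<close> unfolding K_def by blast
        then show ?thesis using that[of I J p q 0] that[of I J p q 1] v(1) by auto
      qed
      obtain I' J' p' q' X' Y' where 2: "v = emb h I' J' p' q' (X', Y')"
        "I' < h" "J' < h" "p' < 2" "q' < 2" "2 \<le> X'"
      proof -
        consider "s = closing_switch h"
          | I J p q where "s = column_switch h I J p q" "Suc I < h" "J < h" "p < 2" "q < 2"
          using \<open>s \<in> tour_switches h\<close> unfolding tour_switches_def by blast
        then show ?thesis
        proof cases
          case 1
          with v(2) have "v \<in> switch_verts (closing_switch h)" by simp
          then obtain I q X Y where "v = emb h I 0 1 q (X, Y)" "I = 0 \<or> I = h - 1" "q < 2" "X \<ge> 4"
            by (rule switch_verts_closing)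
          then show ?thesis using that[of I 0 1 q X Y] h by auto
        next
          case (2 I J p q)
          with v(2) have "v \<in> switch_verts (column_switch h I J p q)" by simp
          then obtain K X where "v = emb h K J p q (X, if K = I then 3 - p else 2 + p)"
            "X = 2 \<or> X = 3" "K = I \<or> K = Suc I" by (rule switch_verts_column)
          then show ?thesis using that[of K J p q X] 2 by auto
        qed
      qed
      have "emb h I J p q (X, 0) = emb h I' J' p' q' (X', Y')" using 1 2 by simp
      from emb_eqD[OF this] show False using 1 2 by auto
    qed
  qed (rule cover_connected[OF h])
  then obtain vs where vs: "hamiltonian_cycle (board (6 * (2 * h) + 2)) (tour_edges h) vs"
    "K \<subseteq> cycle_edges vs" by blast
  have "structured a vs"
    unfolding structured_def
  proof (intro allI impI)
    fix i j assume "i < a" "j < a"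
    then have "i div 2 < h" "j div 2 < h" unfolding a by auto
    then have "{(int i, int j), (int i + int a, int j + (- 1) ^ j)} \<in> K"
      unfolding K_def a structured_edge_emb by fastforce
    then show "{(int i, int j), (int i + int a, int j + (- 1) ^ j)} \<in> cycle_edges vs"
      using vs(2) by blast
  qed
  then show ?thesis using vs(1) a unfolding knight_tour_def by blast
qed

end
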